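(* Let $\nabla$ be a cl-connection on $\mathbb{R}^2$ determined by $(W,m,n)$, where $W=(\cos\theta_0,\sin\theta_0)$, and let $\lambda>0$ be a constant. Let $\gamma:I\to\mathbb{R}^2$ be a smooth curve parametrized by arc length such that $m+n=\lambda$ along $\gamma$ and whose tangential curvature with respect to $\nabla$ is $\kappa_t(s)=s$ for $s\in(-\lambda,\lambda)$. Then, up to a rigid translation, $\gamma(s)$ is given, for a suitable choice of the signs, by $$\gamma(s)=R_{\theta_0}\left(\pm\frac{s^2}{2\lambda},\ \pm\left[\frac{s}{2}\sqrt{1-\frac{s^2}{\lambda^2}}+\frac{\lambda}{2}\arcsin\left(\frac{s}{\lambda}\right)\right]\right).$$
   Context: $\langle\cdot,\cdot\rangle$ is the Euclidean metric on $\mathbb{R}^2$ and $\nabla^0$ its Levi-Civita connection. Let $W$ be a constant unit vector field on $\mathbb{R}^2$ and let $m,n:\mathbb{R}^2\to\mathbb{R}$ be smooth functions, not both identically zero. The canonical linear connection (cl-connection) determined by $(W,m,n)$ is $$\nabla_XY=\nabla^0_XY+m\langle W,Y\rangle X+n\langle X,Y\rangle W .$$ For a smooth curve $\gamma$ parametrized by arc length with unit tangent $T=\gamma'$, the tangential curvature of $\gamma$ with respect to $\nabla$ is $\kappa_t=(m+n)\langle W,T\rangle$, where $m,n$ are evaluated along $\gamma$. $R_\theta$ denotes the rotation of $\mathbb{R}^2$ about the origin by the angle $\theta$. *)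

theory Defs
  imports "HOL-Analysis.Analysis"
begin

type_synonym vfield = "real^2 \<Rightarrow> real^2"

(* C^k and C-infinity on an open set: on a Euclidean space, a map is C^(k+1) iff it is
   differentiable and all its directional derivatives are C^k. *)
primrec Ck_on :: "nat \<Rightarrow> 'a::euclidean_space set \<Rightarrow> ('a \<Rightarrow> 'b::real_normed_vector) \<Rightarrow> bool"
  where
    "Ck_on 0 S f \<longleftrightarrow> continuous_on S f"
  | "Ck_on (Suc k) S f \<longleftrightarrow>
       (\<forall>x\<in>S. f differentiable (at x)) \<and>
       (\<forall>v. Ck_on k S (\<lambda>x. frechet_derivative f (at x) v))"

definition smooth_on :: "'a::euclidean_space set \<Rightarrow> ('a \<Rightarrow> 'b::real_normed_vector) \<Rightarrow> bool"
  where "smooth_on S f \<longleftrightarrow> (\<forall>k. Ck_on k S f)"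

(* The Levi-Civita connection of the Euclidean metric: the directional derivative of Y along X. *)
definition flat_connection :: "vfield \<Rightarrow> vfield \<Rightarrow> vfield"
  where "flat_connection X Y = (\<lambda>p. frechet_derivative Y (at p) (X p))"

definition constant_unit_field :: "vfield \<Rightarrow> bool"
  where "constant_unit_field W \<longleftrightarrow> (\<exists>w. norm w = 1 \<and> W = (\<lambda>_. w))"

(* A connection acts on smooth vector fields only, so nothing is required of nabla elsewhere. *)
definition cl_connection ::
    "(vfield \<Rightarrow> vfield \<Rightarrow> vfield) \<Rightarrow> vfield \<Rightarrow> (real^2 \<Rightarrow> real) \<Rightarrow> (real^2 \<Rightarrow> real) \<Rightarrow> bool"
  where "cl_connection nabla W m n \<longleftrightarrow>
    constant_unit_field W \<and> smooth_on UNIV m \<and> smooth_on UNIV n \<and>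
    \<not> ((\<forall>p. m p = 0) \<and> (\<forall>p. n p = 0)) \<and>
    (\<forall>X Y. smooth_on UNIV X \<longrightarrow> smooth_on UNIV Y \<longrightarrow>
      (\<forall>p. nabla X Y p =
        flat_connection X Y p + (m p * (W p \<bullet> Y p)) *\<^sub>R X p + (n p * (X p \<bullet> Y p)) *\<^sub>R W p))"

definition unit_speed_curve :: "real set \<Rightarrow> (real \<Rightarrow> real^2) \<Rightarrow> bool"
  where "unit_speed_curve I \<gamma> \<longleftrightarrow>
    smooth_on I \<gamma> \<and> (\<forall>s\<in>I. norm (vector_derivative \<gamma> (at s)) = 1)"

definition tangential_curvature ::
    "vfield \<Rightarrow> (real^2 \<Rightarrow> real) \<Rightarrow> (real^2 \<Rightarrow> real) \<Rightarrow> (real \<Rightarrow> real^2) \<Rightarrow> real \<Rightarrow> real"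
  where "tangential_curvature W m n \<gamma> s =
    (m (\<gamma> s) + n (\<gamma> s)) * (W (\<gamma> s) \<bullet> vector_derivative \<gamma> (at s))"

definition rot :: "real \<Rightarrow> real^2 \<Rightarrow> real^2"
  where "rot \<theta> p = vector [cos \<theta> * p$1 - sin \<theta> * p$2, sin \<theta> * p$1 + cos \<theta> * p$2]"

end

theory Submission
  imports Defs
begin

text \<open>
  Let \<open>e\<close> and \<open>e'\<close> be the images of the coordinate vectors under the rotation, so that \<open>e\<close> is the
  constant value of \<open>W\<close>.  Where \<open>m + n = lam\<close>, the curvature equation says that the
  \<open>e\<close>-component of the unit tangent at parameter \<open>s\<close> is \<open>s / lam\<close>.  Since the tangent has length 1,
  its \<open>e'\<close>-component is a square root of \<open>1 - s\<^sup>2 / lam\<^sup>2\<close>, which does not vanish for \<open>\<bar>s\<bar> < lam\<close>;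
  being continuous, that component has the same sign for all \<open>s\<close>
  (lemma \<open>continuous_square_root_sign\<close>).  Up to this one global choice of sign, the
  velocity is therefore known, and two curves with the same velocity on an interval differ by a
  translation (lemma \<open>same_velocity_imp_translate\<close>).  Integrating \<open>sqrt (1 - s\<^sup>2 / lam\<^sup>2)\<close> gives the
  area-type primitive in the second coordinate.  In the first coordinate \<open>s / lam\<close>
  integrates to \<open>s\<^sup>2 / (2 * lam)\<close>, so the sign there is always \<open>+\<close>.
\<close>

lemma rot_vector_eq_frame:
  "rot \<theta> (vector [x, y]) = x *\<^sub>R vector [cos \<theta>, sin \<theta>] + y *\<^sub>R vector [- sin \<theta>, cos \<theta>]"
  by (simp add: rot_def vec_eq_iff forall_2)

lemma unit_vector_in_rotated_frame:
  fixes v :: "real^2" and \<theta> :: real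
  assumes "norm v = 1"
  defines "a \<equiv> vector [cos \<theta>, sin \<theta>] \<bullet> v" and "b \<equiv> vector [- sin \<theta>, cos \<theta>] \<bullet> v"
  shows "v = rot \<theta> (vector [a, b])" and "b\<^sup>2 = 1 - a\<^sup>2"
proof -
  have ab: "a = cos \<theta> * v$1 + sin \<theta> * v$2" "b = cos \<theta> * v$2 - sin \<theta> * v$1"
    by (simp_all add: a_def b_def inner_vec_def sum_2)
  have cs: "(cos \<theta>)\<^sup>2 + (sin \<theta>)\<^sup>2 = 1"
    by simp
  have "cos \<theta> * a - sin \<theta> * b = v$1" "sin \<theta> * a + cos \<theta> * b = v$2"
    using cs unfolding ab by algebra+
  then show "v = rot \<theta> (vector [a, b])"
    by (simp add: rot_def vec_eq_iff forall_2)
  have "(v$1)\<^sup>2 + (v$2)\<^sup>2 = 1"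
    using assms(1) by (simp add: norm_vec_def L2_set_def sum_2)
  then show "b\<^sup>2 = 1 - a\<^sup>2"
    using cs unfolding ab by algebra
qed

text \<open>
  Smoothness is phrased through Frechet derivatives; on the line these are determined by
  their value at 1, which is the velocity.
\<close>

lemma smooth_on_continuous_velocity:
  fixes \<gamma> :: "real \<Rightarrow> 'b::real_normed_vector"
  assumes "smooth_on S \<gamma>"
  shows "s \<in> S \<Longrightarrow> (\<gamma> has_vector_derivative vector_derivative \<gamma> (at s)) (at s)"
    and "continuous_on S (\<lambda>s. vector_derivative \<gamma> (at s))"
proof -
  have "Ck_on (Suc 0) S \<gamma>"
    using assms unfolding smooth_on_def by blast
  then have diff: "\<forall>s\<in>S. \<gamma> differentiable (at s)"
    and cont: "continuous_on S (\<lambda>s. frechet_derivative \<gamma> (at s) 1)"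
    by auto
  have vd: "(\<gamma> has_vector_derivative vector_derivative \<gamma> (at s)) (at s)" if "s \<in> S" for s
    using diff that vector_derivative_works by blast
  then show "s \<in> S \<Longrightarrow> (\<gamma> has_vector_derivative vector_derivative \<gamma> (at s)) (at s)" .
  have "frechet_derivative \<gamma> (at s) 1 = vector_derivative \<gamma> (at s)" if "s \<in> S" for s
    using frechet_derivative_at[OF vd[OF that, unfolded has_vector_derivative_def], symmetric]
    by simp
  then show "continuous_on S (\<lambda>s. vector_derivative \<gamma> (at s))"
    using cont continuous_on_cong by force
qed

text \<open>
  By the intermediate value theorem in its connectedness form, a change of sign would produce a
  zero of the function, where the positive quantity under the root would vanish.
\<close>

lemma continuous_square_root_sign:
  fixes f q :: "'a::topological_space \<Rightarrow> real"
  assumes "connected S" and "continuous_on S f"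
    and "\<And>x. x \<in> S \<Longrightarrow> (f x)\<^sup>2 = q x" and "\<And>x. x \<in> S \<Longrightarrow> q x > 0"
  obtains \<epsilon> where "\<epsilon> \<in> {1, -1}" and "\<And>x. x \<in> S \<Longrightarrow> f x = \<epsilon> * sqrt (q x)"
proof -
  have nz: "f x \<noteq> 0" if "x \<in> S" for x
    using assms(3,4)[OF that] by auto
  have conn: "connected (f ` S)"
    using assms(1,2) by (rule connected_continuous_image[rotated])
  have abs: "sqrt (q x) = \<bar>f x\<bar>" if "x \<in> S" for x
    using assms(3)[OF that] by (metis real_sqrt_abs)
  have no_change: "\<not> (f x < 0 \<and> 0 < f y)" if "x \<in> S" "y \<in> S" for x y
  proof
    assume "f x < 0 \<and> 0 < f y"
    then have "0 \<in> f ` S"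
      using connectedD_interval[OF conn, of "f x" "f y" 0] that by auto
    then show False
      using nz by auto
  qed
  show thesis
  proof (cases "\<exists>x\<in>S. f x > 0")
    case True
    then obtain y where "y \<in> S" "f y > 0"
      by blast
    then have "f x = 1 * sqrt (q x)" if "x \<in> S" for x
      using no_change[OF that \<open>y \<in> S\<close>] nz[OF that] abs[OF that] by auto
    then show thesis
      using that[of 1] by blast
  next
    case False
    then have "f x = -1 * sqrt (q x)" if "x \<in> S" for x
      using abs[OF that] that by force
    then show thesis
      using that[of "-1"] by blast
  qed
qed

lemma one_minus_square_ratio_pos:
  fixes r s :: real
  assumes "\<bar>s\<bar> < r"
  shows "1 - s\<^sup>2 / r\<^sup>2 > 0"
  using power_strict_mono[OF assms, of 2] assms by (simp add: field_simps)

lemma has_derivative_primitive_of_semicircle: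
  fixes r s :: real
  assumes "\<bar>s\<bar> < r"
  shows "((\<lambda>s. s / 2 * sqrt (1 - s\<^sup>2 / r\<^sup>2) + r / 2 * arcsin (s / r))
          has_real_derivative sqrt (1 - s\<^sup>2 / r\<^sup>2)) (at s)"
proof -
  define w where "w = sqrt (1 - s\<^sup>2 / r\<^sup>2)"
  have r: "r > 0"
    using assms by linarith
  have pos: "1 - s\<^sup>2 / r\<^sup>2 > 0"
    using assms by (rule one_minus_square_ratio_pos)
  then have w: "w > 0" "w\<^sup>2 = 1 - s\<^sup>2 / r\<^sup>2"
    by (simp_all add: w_def)
  have bounds: "-1 < s / r" "s / r < 1"
    using assms r by (auto simp: field_simps)
  have "((\<lambda>s. 1 - s\<^sup>2 / r\<^sup>2) has_real_derivative - (2 * s / r\<^sup>2)) (at s)"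
    using DERIV_diff[OF DERIV_const[of 1] DERIV_cdivide[OF DERIV_pow[of 2 s], of "r\<^sup>2"]]
    by simp
  from DERIV_chain2[OF DERIV_real_sqrt[OF pos] this]
  have root: "((\<lambda>s. sqrt (1 - s\<^sup>2 / r\<^sup>2)) has_real_derivative - (s / r\<^sup>2) / w) (at s)"
    by (simp add: w_def field_simps)
  have "((\<lambda>s. s / r) has_real_derivative 1 / r) (at s)"
    by (intro DERIV_cdivide DERIV_ident)
  from DERIV_chain2[OF DERIV_arcsin[OF bounds] this]
  have arc: "((\<lambda>s. arcsin (s / r)) has_real_derivative 1 / (r * w)) (at s)"
    by (simp add: w_def power_divide field_simps)
  have half: "((\<lambda>s. s / 2) has_real_derivative 1 / 2) (at s)"
    by (intro DERIV_cdivide DERIV_ident)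
  \<comment> \<open>Half of \<open>w\<close> comes from the factor \<open>s / 2\<close>; the other two terms combine to
    \<open>w\<^sup>2 / (2 * w)\<close>, which supplies the other half.\<close>
  have "1 / 2 * w + - (s / r\<^sup>2) / w * (s / 2) + r / 2 * (1 / (r * w))
      = w / 2 + (1 - s\<^sup>2 / r\<^sup>2) / (2 * w)"
    using r by (simp add: diff_divide_distrib power2_eq_square ac_simps)
  also have "\<dots> = w"
    using w(1) unfolding w(2)[symmetric] by (simp add: power2_eq_square)
  finally show ?thesis
    using DERIV_add[OF DERIV_mult[OF half root] DERIV_cmult[OF arc, of "r / 2"]]
    unfolding w_def[symmetric] by simp
qed

text \<open>
  Only the velocity is prescribed, so the integration constant is the translation left free in the
  classification.
\<close>

lemma same_velocity_imp_translate:
  fixes f g :: "real \<Rightarrow> 'b::real_normed_vector"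
  assumes "convex S"
    and f: "\<And>s. s \<in> S \<Longrightarrow> (f has_vector_derivative v s) (at s)"
    and g: "\<And>s. s \<in> S \<Longrightarrow> (g has_vector_derivative v s) (at s)"
  obtains c where "\<And>s. s \<in> S \<Longrightarrow> f s = c + g s"
proof -
  have "((\<lambda>s. f s - g s) has_vector_derivative 0) (at s within S)" if "s \<in> S" for s
    using has_vector_derivative_diff[OF f[OF that] g[OF that]]
    by (simp add: has_vector_derivative_at_within)
  then obtain c where "\<And>s. s \<in> S \<Longrightarrow> f s - g s = c"
    using has_vector_derivative_zero_constant[OF assms(1)] by blast
  then show thesis
    using that[of c] by (metis diff_add_cancel)
qed

theorem theorem5p1:
  fixes nabla :: "vfield \<Rightarrow> vfield \<Rightarrow> vfield"
    and W :: vfield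
    and m n :: "real^2 \<Rightarrow> real"
    and \<theta>\<^sub>0 lam :: real
    and I :: "real set"
    and \<gamma> :: "real \<Rightarrow> real^2"
  assumes "cl_connection nabla W m n"
    and "W = (\<lambda>_. vector [cos \<theta>\<^sub>0, sin \<theta>\<^sub>0])"
    and "lam > 0"
    and "open I" and "is_interval I" and "{-lam<..<lam} \<subseteq> I"
    and "unit_speed_curve I \<gamma>"
    and "\<forall>s\<in>I. m (\<gamma> s) + n (\<gamma> s) = lam"
    and "\<forall>s\<in>{-lam<..<lam}. tangential_curvature W m n \<gamma> s = s"
  shows "\<exists>\<epsilon>\<^sub>1\<in>{1, -1}. \<exists>\<epsilon>\<^sub>2\<in>{1, -1}. \<exists>c. \<forall>s\<in>{-lam<..<lam}.
    \<gamma> s = c + rot \<theta>\<^sub>0 (vector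
      [\<epsilon>\<^sub>1 * (s\<^sup>2 / (2 * lam)),
       \<epsilon>\<^sub>2 * (s / 2 * sqrt (1 - s\<^sup>2 / lam\<^sup>2) + lam / 2 * arcsin (s / lam))])"
proof -
  let ?J = "{-lam<..<lam}"
  define T where "T = (\<lambda>s. vector_derivative \<gamma> (at s))"
  define e :: "real^2" where "e = vector [cos \<theta>\<^sub>0, sin \<theta>\<^sub>0]"
  define e' :: "real^2" where "e' = vector [- sin \<theta>\<^sub>0, cos \<theta>\<^sub>0]"
  have unit: "\<forall>s\<in>I. norm (T s) = 1" and "smooth_on I \<gamma>"
    using assms(7) by (auto simp: unit_speed_curve_def T_def)
  note vel = smooth_on_continuous_velocity[OF this(2), folded T_def]
  have tangent: "e \<bullet> T s = s / lam" if "s \<in> ?J" for s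
  proof -
    have "m (\<gamma> s) + n (\<gamma> s) = lam"
      using assms(6,8) that by blast
    moreover have "(m (\<gamma> s) + n (\<gamma> s)) * (e \<bullet> T s) = s"
      using assms(2,9) that by (simp add: tangential_curvature_def e_def T_def)
    ultimately show ?thesis
      using assms(3) by (simp add: field_simps)
  qed
  have frame: "T s = (s / lam) *\<^sub>R e + (e' \<bullet> T s) *\<^sub>R e'"
    and normal: "(e' \<bullet> T s)\<^sup>2 = 1 - s\<^sup>2 / lam\<^sup>2" if "s \<in> ?J" for s
  proof -
    have "norm (T s) = 1"
      using unit that assms(6) by blast
    note decomp = unit_vector_in_rotated_frame[OF this, of \<theta>\<^sub>0, folded e_def e'_def,
      unfolded tangent[OF that]]
    show "T s = (s / lam) *\<^sub>R e + (e' \<bullet> T s) *\<^sub>R e'"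
      using decomp(1) unfolding rot_vector_eq_frame e_def[symmetric] e'_def[symmetric] .
    show "(e' \<bullet> T s)\<^sup>2 = 1 - s\<^sup>2 / lam\<^sup>2"
      using decomp(2) by (simp add: power_divide)
  qed
  have "1 - s\<^sup>2 / lam\<^sup>2 > 0" if "s \<in> ?J" for s
    using that by (intro one_minus_square_ratio_pos) auto
  moreover have "continuous_on ?J (\<lambda>s. e' \<bullet> T s)"
    using continuous_on_subset[OF vel(2) assms(6)] by (intro continuous_intros)
  ultimately obtain \<epsilon> where \<epsilon>: "\<epsilon> \<in> {1, -1}"
    and root: "\<And>s. s \<in> ?J \<Longrightarrow> e' \<bullet> T s = \<epsilon> * sqrt (1 - s\<^sup>2 / lam\<^sup>2)"
    using continuous_square_root_sign[of ?J "\<lambda>s. e' \<bullet> T s" "\<lambda>s. 1 - s\<^sup>2 / lam\<^sup>2"] normal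
    by (metis connected_Ioo)
  define F where "F = (\<lambda>s. s / 2 * sqrt (1 - s\<^sup>2 / lam\<^sup>2) + lam / 2 * arcsin (s / lam))"
  define g where "g = (\<lambda>s. rot \<theta>\<^sub>0 (vector [1 * (s\<^sup>2 / (2 * lam)), \<epsilon> * F s]))"
  have "(g has_vector_derivative T s) (at s)" if "s \<in> ?J" for s
  proof -
    have "(F has_real_derivative sqrt (1 - s\<^sup>2 / lam\<^sup>2)) (at s)"
      using has_derivative_primitive_of_semicircle[of s lam] that by (auto simp: F_def)
    then have "((\<lambda>s. \<epsilon> * F s) has_real_derivative e' \<bullet> T s) (at s)"
      unfolding root[OF that] by (rule DERIV_cmult)
    moreover have "((\<lambda>s. 1 * (s\<^sup>2 / (2 * lam))) has_real_derivative s / lam) (at s)"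
      using assms(3) by (auto intro!: derivative_eq_intros simp: less_imp_neq[symmetric])
    ultimately have "((\<lambda>s. (1 * (s\<^sup>2 / (2 * lam))) *\<^sub>R e + (\<epsilon> * F s) *\<^sub>R e')
        has_vector_derivative (s / lam) *\<^sub>R e + (e' \<bullet> T s) *\<^sub>R e') (at s)"
      using has_vector_derivative_scaleR[OF _ has_vector_derivative_const]
        has_vector_derivative_add by fastforce
    then show ?thesis
      unfolding g_def rot_vector_eq_frame e_def[symmetric] e'_def[symmetric]
        frame[OF that, symmetric] .
  qed
  moreover have "(\<gamma> has_vector_derivative T s) (at s)" if "s \<in> ?J" for s
    using vel(1) that assms(6) by (auto simp: T_def)
  ultimately obtain c where "\<And>s. s \<in> ?J \<Longrightarrow> \<gamma> s = c + g s"
    using same_velocity_imp_translate[of ?J \<gamma> T g] by (metis convex_real_interval(8))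
  then show ?thesis
    using \<epsilon> unfolding g_def F_def by blast
qed

end
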